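(* Let $\mathscr{P}_n$ be the set of all consistent path systems on $n$ vertices and $\mathscr{M}_n$ the set of all consistent metric path systems on $n$ vertices. Then, as $n\to\infty$, $$n^{\frac{n^2}{2}(1-o(1))}\le |\mathscr{M}_n|\le |\mathscr{P}_n|\le n^{\frac{n^2}{2}}.$$
   Context: A consistent path system $\mathcal{P}$ in a finite simple undirected graph $G=(V,E)$ is a collection of simple paths in $G$ such that: (1) for every pair of distinct vertices $u,v\in V$ there is exactly one path in $\mathcal{P}$ with end vertices $u,v$, denoted $P_{u,v}=P_{v,u}$ (paths are undirected); (2) the non-empty intersection of any two paths in $\mathcal{P}$ is either a single vertex or a path in $\mathcal{P}$. A path system on $n$ vertices means one in the complete graph $K_n$ on the vertex set $[n]=\{1,\dots,n\}$. A path system $\mathcal{P}$ in $G=(V,E)$ is metric if there is a weight function $w:E\to\mathbb{R}_{>0}$ such that each path in $\mathcal{P}$ is a $w$-shortest path between its end vertices (the weight of a path being the sum of the weights of its edges). *)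

theory Defs
  imports Complex_Main "HOL-Library.Landau_Symbols"
begin

text \<open>An undirected graph is a pair of a vertex set and a set of edges, each edge being a
  two-element set of vertices.\<close>

type_synonym 'a ugraph = "'a set \<times> 'a set set"

definition simple_graph :: "'a ugraph \<Rightarrow> bool" where
  "simple_graph G \<longleftrightarrow>
     finite (fst G) \<and> (\<forall>e\<in>snd G. \<exists>u\<in>fst G. \<exists>v\<in>fst G. u \<noteq> v \<and> e = {u, v})"

definition walk_edges :: "'a list \<Rightarrow> 'a set set" where
  "walk_edges xs = {{xs ! i, xs ! Suc i} | i. Suc i < length xs}"

text \<open>A simple path is the subgraph traced out by a non-repeating sequence of consecutively
  adjacent vertices. As a subgraph it carries no direction (see \<open>path_between_commute\<close>).\<close>

definition path_between :: "'a ugraph \<Rightarrow> 'a \<Rightarrow> 'a \<Rightarrow> 'a ugraph \<Rightarrow> bool" where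
  "path_between G u v p \<longleftrightarrow>
     (\<exists>xs. xs \<noteq> [] \<and> distinct xs \<and> hd xs = u \<and> last xs = v \<and>
           set xs \<subseteq> fst G \<and> walk_edges xs \<subseteq> snd G \<and>
           p = (set xs, walk_edges xs))"

definition graph_inter :: "'a ugraph \<Rightarrow> 'a ugraph \<Rightarrow> 'a ugraph" where
  "graph_inter p q = (fst p \<inter> fst q, snd p \<inter> snd q)"

text \<open>The members of a path system join distinct vertices; one-vertex paths are not members,
  which is why a single vertex is listed separately as a possible intersection.\<close>

definition consistent_path_system :: "'a ugraph \<Rightarrow> 'a ugraph set \<Rightarrow> bool" where
  "consistent_path_system G P \<longleftrightarrow>
     simple_graph G \<and>
     (\<forall>p\<in>P. \<exists>u\<in>fst G. \<exists>v\<in>fst G. u \<noteq> v \<and> path_between G u v p) \<and>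
     (\<forall>u\<in>fst G. \<forall>v\<in>fst G. u \<noteq> v \<longrightarrow> (\<exists>!p. p \<in> P \<and> path_between G u v p)) \<and>
     (\<forall>p\<in>P. \<forall>q\<in>P. fst p \<inter> fst q \<noteq> {} \<longrightarrow>
        (\<exists>x. graph_inter p q = ({x}, {})) \<or> graph_inter p q \<in> P)"

definition path_weight :: "('a set \<Rightarrow> real) \<Rightarrow> 'a ugraph \<Rightarrow> real" where
  "path_weight w p = (\<Sum>e\<in>snd p. w e)"

definition shortest_path :: "'a ugraph \<Rightarrow> ('a set \<Rightarrow> real) \<Rightarrow> 'a \<Rightarrow> 'a \<Rightarrow> 'a ugraph \<Rightarrow> bool" where
  "shortest_path G w u v p \<longleftrightarrow>
     path_between G u v p \<and> (\<forall>q. path_between G u v q \<longrightarrow> path_weight w p \<le> path_weight w q)"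

text \<open>Only the values of the weight function on the edges of the graph matter.\<close>

definition metric_path_system :: "'a ugraph \<Rightarrow> 'a ugraph set \<Rightarrow> bool" where
  "metric_path_system G P \<longleftrightarrow>
     (\<exists>w. (\<forall>e\<in>snd G. w e > 0) \<and>
          (\<forall>p\<in>P. \<forall>u v. path_between G u v p \<longrightarrow> shortest_path G w u v p))"

definition complete_graph :: "nat \<Rightarrow> nat ugraph" where
  "complete_graph n = ({1..n}, {{u, v} | u v. u \<in> {1..n} \<and> v \<in> {1..n} \<and> u \<noteq> v})"

definition consistent_systems :: "nat \<Rightarrow> nat ugraph set set" where
  "consistent_systems n = {P. consistent_path_system (complete_graph n) P}"

definition metric_systems :: "nat \<Rightarrow> nat ugraph set set" where
  "metric_systems n = {P \<in> consistent_systems n. metric_path_system (complete_graph n) P}"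

lemma simple_graph_complete_graph: "simple_graph (complete_graph n)"
proof -
  have "finite (fst (complete_graph n))"
    by (simp add: complete_graph_def)
  moreover have "\<exists>u\<in>fst (complete_graph n). \<exists>v\<in>fst (complete_graph n). u \<noteq> v \<and> e = {u, v}"
    if "e \<in> snd (complete_graph n)" for e
    using that unfolding complete_graph_def fst_conv snd_conv by blast
  ultimately show ?thesis
    unfolding simple_graph_def by blast
qed

lemma walk_edges_rev: "walk_edges (rev xs) = walk_edges xs"
proof -
  have sub: "walk_edges (rev ys) \<subseteq> walk_edges ys" for ys :: "'a list"
  proof
    fix e assume "e \<in> walk_edges (rev ys)"
    then obtain i where i: "Suc i < length ys" "e = {rev ys ! i, rev ys ! Suc i}"
      by (auto simp: walk_edges_def)
    define j where "j = length ys - Suc (Suc i)"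
    have j: "Suc j < length ys" "length ys - Suc i = Suc j"
      using i(1) unfolding j_def by arith+
    have "rev ys ! i = ys ! Suc j" "rev ys ! Suc i = ys ! j"
      using i(1) by (simp_all only: rev_nth j(2) j_def Suc_lessD)
    then have "e = {ys ! j, ys ! Suc j}"
      using i(2) by (simp add: insert_commute)
    then show "e \<in> walk_edges ys"
      using j(1) by (auto simp: walk_edges_def)
  qed
  show ?thesis
    using sub[of xs] sub[of "rev xs"] by simp
qed

lemma path_between_commute: "path_between G u v p \<longleftrightarrow> path_between G v u p"
proof -
  have "path_between G b a p" if asm: "path_between G a b p" for a b
  proof -
    obtain xs where xs: "xs \<noteq> []" "distinct xs" "hd xs = a" "last xs = b"
      "set xs \<subseteq> fst G" "walk_edges xs \<subseteq> snd G" "p = (set xs, walk_edges xs)"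
      using asm unfolding path_between_def by blast
    have "rev xs \<noteq> [] \<and> distinct (rev xs) \<and> hd (rev xs) = b \<and> last (rev xs) = a \<and>
        set (rev xs) \<subseteq> fst G \<and> walk_edges (rev xs) \<subseteq> snd G \<and>
        p = (set (rev xs), walk_edges (rev xs))"
      using xs by (simp only: walk_edges_rev hd_rev last_rev set_rev distinct_rev
          rev_is_Nil_conv not_False_eq_True simp_thms)
    then show ?thesis
      unfolding path_between_def by (rule exI)
  qed
  then show ?thesis by blast
qed

end

theory Submission imports Defs "HOL-Library.FuncSet" "HOL-Real_Asymp.Real_Asymp" begin

text \<open>
  Upper bound. In a consistent system every segment of a member is again a member
  (\<open>consistent_segment\<close>), so once an interior vertex \<open>x\<close> of \<open>P\<^bsub>u,v\<^esub>\<close> is known, \<open>P\<^bsub>u,v\<^esub>\<close> is the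
  union of the shorter members \<open>P\<^bsub>u,x\<^esub>\<close> and \<open>P\<^bsub>x,v\<^esub>\<close>. Hence the system can be rebuilt, by recursion
  on the number of vertices of a path, from one interior vertex for each unordered pair; a pair
  joined by a single edge is marked by one of its own two ends. One symbol out of \<open>n\<close> for each of
  the \<open>n choose 2 \<le> n\<^sup>2 / 2\<close> pairs gives the bound (\<open>card_consistent_path_systems_le\<close>).

  Lower bound. A member of a metric system has to be a shortest path, but not the only one, and
  this leaves enough room for a very simple family. Fix a set \<open>H\<close> of \<open>h\<close> hubs. Join two vertices
  by their edge if one of them is a hub, and by a path with two edges through an arbitrarily
  chosen hub otherwise. Any such choice is consistent, because two of these paths can share an edge
  only if they run through the same hub. Giving weight 1 to the edges that meet \<open>H\<close> and weight 2
  to the others, all two-edge routes between two vertices outside \<open>H\<close> tie with their direct edge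
  at the minimal weight 2, so every choice is also metric. Distinct choices give distinct systems,
  which makes at least \<open>h ^ (n - h choose 2)\<close> of them (\<open>card_metric_systems_ge\<close>). The hubs should
  be a vanishing fraction of the vertices but \<open>ln h\<close> should still be asymptotic to \<open>ln n\<close>; taking
  \<open>h\<close> close to \<open>n / ln n\<close> achieves both (\<open>hub_exponent_tendsto\<close>).
\<close>

section \<open>Edges of a vertex sequence\<close>

lemma walk_edges_Nil [simp]: "walk_edges [] = {}"
  and walk_edges_single [simp]: "walk_edges [x] = {}"
  by (simp_all add: walk_edges_def)

lemma walk_edges_Cons_Cons [simp]:
  "walk_edges (x # y # zs) = insert {x, y} (walk_edges (y # zs))"
proof -
  have "e \<in> walk_edges (x # y # zs) \<longleftrightarrow> e = {x, y} \<or> e \<in> walk_edges (y # zs)" for e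
  proof -
    have "e \<in> walk_edges (x # y # zs) \<longleftrightarrow>
        (\<exists>i. i < Suc (length zs) \<and> e = {(x # y # zs) ! i, (y # zs) ! i})"
      by (auto simp: walk_edges_def)
    also have "\<dots> \<longleftrightarrow> e = {x, y} \<or> (\<exists>i < length zs. e = {(y # zs) ! i, zs ! i})"
      by (auto simp: less_Suc_eq_0_disj)
    also have "\<dots> \<longleftrightarrow> e = {x, y} \<or> e \<in> walk_edges (y # zs)"
      by (auto simp: walk_edges_def)
    finally show ?thesis .
  qed
  then show ?thesis by blast
qed

lemma walk_edges_append:
  "walk_edges (as @ x # bs) = walk_edges (as @ [x]) \<union> walk_edges (x # bs)"
proof (induction as)
  case (Cons a as)
  then show ?case by (cases as) auto
qed simp

lemma walk_edges_subset_Pow: "walk_edges xs \<subseteq> Pow (set xs)"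
  by (auto simp: walk_edges_def)

lemma finite_walk_edges: "finite (walk_edges xs)"
  by (rule finite_subset [OF walk_edges_subset_Pow]) simp

lemma walk_edges_splitE:
  assumes "e \<in> walk_edges xs"
  obtains as a b bs where "xs = as @ a # b # bs" "e = {a, b}"
proof -
  obtain i where i: "Suc i < length xs" "e = {xs ! i, xs ! Suc i}"
    using assms by (auto simp: walk_edges_def)
  have "xs = take i xs @ xs ! i # xs ! Suc i # drop (Suc (Suc i)) xs"
    using i(1) by (simp add: Cons_nth_drop_Suc)
  then show thesis using that i(2) by blast
qed

lemma Union_walk_edges: "length xs \<ge> 2 \<Longrightarrow> \<Union> (walk_edges xs) = set xs"
proof (induction xs rule: induct_list012)
  case (3 x y zs)
  then show ?case by (cases zs) auto
qed auto

lemma walk_edges_crossing: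
  assumes "a \<in> set ys" "a \<in> S" "b \<in> set ys" "b \<notin> S"
  shows "\<exists>x y. {x, y} \<in> walk_edges ys \<and> x \<in> S \<and> y \<notin> S"
proof (rule ccontr)
  assume "\<not> ?thesis"
  then have "\<forall>x y. {x, y} \<in> walk_edges ys \<longrightarrow> x \<in> S \<longrightarrow> y \<in> S" by blast
  then have "z \<in> S \<longleftrightarrow> hd ys \<in> S" if "z \<in> set ys" for z
    using that
  proof (induction ys rule: induct_list012)
    case (3 x y zs)
    have "x \<in> S \<longleftrightarrow> y \<in> S"
      using 3(3) by (metis insertI1 insert_commute walk_edges_Cons_Cons)
    moreover have "z \<in> S \<longleftrightarrow> y \<in> S" if "z \<in> set (y # zs)"
      using 3(2) 3(3) that by simp
    ultimately show ?case using 3(4) by auto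
  qed auto
  then show False using assms by blast
qed

text \<open>Along a path, the edge \<open>{a, b}\<close> is the only one that leaves the set of vertices up to \<open>a\<close>.
  So a walk that uses only edges of the path and visits both ends of a segment has to cross every
  edge of that segment.\<close>

lemma walk_in_path_covers_segment:
  assumes dist: "distinct (as @ bs @ cs)" and "bs \<noteq> []"
    and sub: "walk_edges ys \<subseteq> walk_edges (as @ bs @ cs)"
    and ends: "hd bs \<in> set ys" "last bs \<in> set ys"
  shows "walk_edges bs \<subseteq> walk_edges ys"
proof
  fix e assume "e \<in> walk_edges bs"
  then obtain b1 a b b2 where bs: "bs = b1 @ a # b # b2" and e: "e = {a, b}"
    by (rule walk_edges_splitE)
  let ?S = "set (as @ b1 @ [a])"
  have split: "walk_edges (as @ bs @ cs) =
      insert {a, b} (walk_edges ((as @ b1) @ [a]) \<union> walk_edges (b # b2 @ cs))"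
    using walk_edges_append [of "as @ b1" a "b # b2 @ cs"] by (simp add: bs)
  have "hd bs \<in> ?S" by (cases b1) (auto simp: bs)
  moreover have "last bs \<in> set (b # b2)"
    unfolding bs by (metis last_ConsR last_appendR last_in_set list.distinct(1))
  then have "last bs \<notin> ?S" using dist by (auto simp: bs)
  ultimately obtain x y where xy: "{x, y} \<in> walk_edges ys" "x \<in> ?S" "y \<notin> ?S"
    using walk_edges_crossing [OF ends(1) _ ends(2), of ?S] by blast
  have "x \<notin> set (b # b2 @ cs)" using xy(2) dist by (auto simp: bs)
  then have "{x, y} \<notin> walk_edges (b # b2 @ cs)"
    using walk_edges_subset_Pow by fastforce
  moreover have "{x, y} \<notin> walk_edges ((as @ b1) @ [a])"
    using walk_edges_subset_Pow [of "(as @ b1) @ [a]"] xy(3) by auto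
  ultimately have "{x, y} = {a, b}"
    using xy(1) sub unfolding split by blast
  then show "e \<in> walk_edges ys" using xy(1) e by simp
qed

section \<open>Consistent path systems are determined by interior vertices\<close>

lemma path_between_ends: "path_between G u v p \<Longrightarrow> u \<in> fst p \<and> v \<in> fst p"
  by (auto simp: path_between_def)

text \<open>An end of a path has degree 1, which is how the ends can be read off from the subgraph.\<close>

lemma path_between_edge_at_end:
  assumes "path_between G u v p" "u \<noteq> v"
  shows "\<exists>!e. e \<in> snd p \<and> u \<in> e"
proof -
  obtain xs where xs: "xs \<noteq> []" "distinct xs" "hd xs = u" "last xs = v"
      "p = (set xs, walk_edges xs)"
    using assms(1) by (auto simp: path_between_def)
  then obtain y zs where "xs = u # y # zs"
    using assms(2) by (metis last.simps list.collapse)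
  then show ?thesis
    using xs walk_edges_subset_Pow [of "y # zs"] by auto
qed

lemma path_between_two_vertices:
  assumes "path_between G u v p" "u \<noteq> v" "fst p = {u, v}"
  shows "p = ({u, v}, {{u, v}})"
proof -
  obtain xs where xs: "xs \<noteq> []" "distinct xs" "hd xs = u" "last xs = v"
      "p = (set xs, walk_edges xs)"
    using assms(1) by (auto simp: path_between_def)
  have "length xs = 2"
    using xs assms(2,3) distinct_card [of xs] by simp
  then have "xs = [u, v]"
    using xs by (auto simp: numeral_2_eq_2 length_Suc_conv)
  then show ?thesis using xs by simp
qed

lemma consistent_path_unique:
  assumes "consistent_path_system G P" "p \<in> P" "q \<in> P"
    and "path_between G u v p" "path_between G u v q" "u \<noteq> v"
  shows "p = q"
proof -
  have "u \<in> fst G" "v \<in> fst G"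
    using assms(4) by (auto simp: path_between_def)
  then show ?thesis
    using assms unfolding consistent_path_system_def by blast
qed

text \<open>Let \<open>q\<close> be the member joining the ends \<open>a\<close> and \<open>b\<close> of the segment. Its intersection with the
  long path contains both \<open>a\<close> and \<open>b\<close>, so it is a member and in particular a walk; lying in the path
  \<open>q\<close> and touching both of its ends, it covers \<open>q\<close>. Thus \<open>q\<close> lies inside the long path, where it has
  to cover the segment, and the segment in turn has to cover \<open>q\<close>.\<close>

lemma consistent_segment:
  assumes cons: "consistent_path_system G P"
    and p: "(set (as @ bs @ cs), walk_edges (as @ bs @ cs)) \<in> P" (is "?p \<in> P")
    and dist: "distinct (as @ bs @ cs)" and V: "set (as @ bs @ cs) \<subseteq> fst G"
    and len: "length bs \<ge> 2"
  shows "(set bs, walk_edges bs) \<in> P"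
proof -
  have ne: "bs \<noteq> []" using len by auto
  let ?a = "hd bs" and ?b = "last bs"
  have ab: "?a \<noteq> ?b"
    using len dist by (cases bs) auto
  have inV: "?a \<in> fst G" "?b \<in> fst G" using ne V by auto
  then obtain q where q: "q \<in> P" "path_between G ?a ?b q"
    using cons ab unfolding consistent_path_system_def by blast
  then obtain zs where zs: "zs \<noteq> []" "distinct zs" "hd zs = ?a" "last zs = ?b"
      "q = (set zs, walk_edges zs)"
    by (auto simp: path_between_def)
  have lenz: "length zs \<ge> 2"
    using zs ab by (cases zs; cases "tl zs") auto
  let ?I = "graph_inter ?p q"
  have abI: "?a \<in> fst ?I" "?b \<in> fst ?I"
    using ne path_between_ends [OF q(2)] by (auto simp: graph_inter_def)
  then have "fst ?p \<inter> fst q \<noteq> {}" "\<nexists>x. ?I = ({x}, {})"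
    using ab by (force simp: graph_inter_def, metis fst_conv singletonD)
  then have "?I \<in> P"
    using cons p q(1) unfolding consistent_path_system_def by blast
  then obtain c d where "path_between G c d ?I"
    using cons unfolding consistent_path_system_def by meson
  then obtain ys where ys: "?I = (set ys, walk_edges ys)"
    unfolding path_between_def by blast
  have "walk_edges zs \<subseteq> walk_edges ys"
    using walk_in_path_covers_segment [of "[]" zs "[]" ys] zs ys abI
    by (auto simp: graph_inter_def)
  then have q_sub: "walk_edges zs \<subseteq> walk_edges (as @ bs @ cs)"
    using ys by (auto simp: graph_inter_def)
  have ab_zs: "?a \<in> set zs" "?b \<in> set zs"
    using zs(1,3,4) by (metis hd_in_set, metis last_in_set)
  have 1: "walk_edges bs \<subseteq> walk_edges zs"
    using walk_in_path_covers_segment [OF dist ne q_sub] ab_zs by blast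
  have 2: "walk_edges zs \<subseteq> walk_edges bs"
    using walk_in_path_covers_segment [of "[]" zs "[]" bs] 1 zs ne by auto
  have "walk_edges zs = walk_edges bs" using 1 2 by blast
  then have "q = (set bs, walk_edges bs)"
    using Union_walk_edges [OF len] Union_walk_edges [OF lenz] zs(5) by simp
  then show ?thesis using q(1) by simp
qed

lemma consistent_split:
  assumes cons: "consistent_path_system G P"
    and p: "p \<in> P" "path_between G u v p" and x: "x \<in> fst p" "x \<noteq> u" "x \<noteq> v"
  obtains q r where "q \<in> P" "r \<in> P" "path_between G u x q" "path_between G x v r"
    "p = (fst q \<union> fst r, snd q \<union> snd r)" "card (fst q) < card (fst p)"
    "card (fst r) < card (fst p)"
proof -
  obtain xs where xs: "xs \<noteq> []" "distinct xs" "hd xs = u" "last xs = v"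
      "set xs \<subseteq> fst G" "walk_edges xs \<subseteq> snd G" "p = (set xs, walk_edges xs)"
    using p(2) by (auto simp: path_between_def)
  obtain as cs where split: "xs = as @ x # cs"
    using x(1) xs(7) by (metis fst_conv split_list)
  have ne: "as \<noteq> []" "cs \<noteq> []"
    using split xs(3,4) x(2,3) by auto
  have edges: "walk_edges xs = walk_edges (as @ [x]) \<union> walk_edges (x # cs)"
    by (simp add: split walk_edges_append [of as x cs])
  let ?q = "(set (as @ [x]), walk_edges (as @ [x]))" and ?r = "(set (x # cs), walk_edges (x # cs))"
  show thesis
  proof
    show "?q \<in> P"
      using consistent_segment [OF cons, of "[]" "as @ [x]" cs] p(1) xs split ne(1)
      by (cases as) auto
    show "?r \<in> P"
      using consistent_segment [OF cons, of as "x # cs" "[]"] p(1) xs split ne(2)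
      by (cases cs) auto
    show "path_between G u x ?q"
      unfolding path_between_def using xs split ne edges
      by (intro exI [of _ "as @ [x]"]) auto
    show "path_between G x v ?r"
      unfolding path_between_def using xs split ne edges
      by (intro exI [of _ "x # cs"]) auto
    show "p = (fst ?q \<union> fst ?r, snd ?q \<union> snd ?r)"
      using xs(7) edges split by auto
    show "card (fst ?q) < card (fst p)"
      using ne xs(2,7) split by (auto simp: distinct_card card_insert_if card_Un_disjoint)
    show "card (fst ?r) < card (fst p)"
      using ne xs(2,7) split by (auto simp: distinct_card card_insert_if card_Un_disjoint)
  qed
qed

text \<open>The code of a pair \<open>e\<close> is a vertex of the member joining it that lies outside \<open>e\<close>, unless the
  member has no further vertex; then it is one of the two elements of \<open>e\<close>. The code therefore also
  tells whether the member is a single edge. The pair is unordered, which is what halves the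
  exponent compared with recording a next vertex for each ordered pair.\<close>

definition interior_code :: "'a ugraph \<Rightarrow> 'a ugraph set \<Rightarrow> 'a set \<Rightarrow> 'a" where
  "interior_code G P e = (SOME x. \<exists>p\<in>P. \<exists>u v. e = {u, v} \<and> path_between G u v p \<and>
      x \<in> fst p \<and> (x \<in> e \<longrightarrow> fst p = e))"

lemma interior_code:
  assumes cons: "consistent_path_system G P"
    and p: "p \<in> P" "path_between G u v p" "u \<noteq> v"
  shows "interior_code G P {u, v} \<in> fst p"
    and "interior_code G P {u, v} \<in> {u, v} \<Longrightarrow> fst p = {u, v}"
proof -
  let ?Q = "\<lambda>x. \<exists>p\<in>P. \<exists>a b. {u, v} = {a, b} \<and> path_between G a b p \<and>
      x \<in> fst p \<and> (x \<in> {u, v} \<longrightarrow> fst p = {u, v})"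
  have "\<exists>x. x \<in> fst p \<and> (x \<in> {u, v} \<longrightarrow> fst p = {u, v})"
    using path_between_ends [OF p(2)] by blast
  then have "\<exists>x. ?Q x" using p by blast
  then have "?Q (interior_code G P {u, v})"
    unfolding interior_code_def by (rule someI_ex)
  then obtain p' a b where p': "p' \<in> P" "{u, v} = {a, b}" "path_between G a b p'"
      "interior_code G P {u, v} \<in> fst p'"
      "interior_code G P {u, v} \<in> {u, v} \<longrightarrow> fst p' = {u, v}"
    by blast
  have "path_between G u v p'"
    using p'(2,3) path_between_commute by (metis doubleton_eq_iff)
  then have "p' = p"
    using consistent_path_unique [OF cons p'(1) p(1)] p by blast
  then show "interior_code G P {u, v} \<in> fst p"
    and "interior_code G P {u, v} \<in> {u, v} \<Longrightarrow> fst p = {u, v}"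
    using p' by auto
qed

text \<open>The recursive decoding, phrased as uniqueness: the two members are either both the edge
  \<open>{u, v}\<close>, or both split at the common code into members with fewer vertices.\<close>

lemma paths_eq_if_same_code:
  assumes P: "consistent_path_system G P" and Q: "consistent_path_system G Q"
    and code: "\<And>u v. u \<in> fst G \<Longrightarrow> v \<in> fst G \<Longrightarrow> u \<noteq> v \<Longrightarrow>
      interior_code G P {u, v} = interior_code G Q {u, v}"
    and "p \<in> P" "path_between G u v p" "q \<in> Q" "path_between G u v q" "u \<noteq> v"
  shows "p = q"
  using assms(4-)
proof (induction "card (fst p)" arbitrary: p q u v rule: less_induct)
  case less
  let ?x = "interior_code G P {u, v}"
  have uv: "u \<in> fst G" "v \<in> fst G"
    using less.prems(2) by (auto simp: path_between_def)
  have xQ: "?x = interior_code G Q {u, v}"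
    using code uv less.prems(5) by blast
  note xp = interior_code [OF P less.prems(1,2,5)]
  note xq = interior_code [OF Q less.prems(3,4,5), folded xQ]
  show ?case
  proof (cases "?x \<in> {u, v}")
    case True
    then show ?thesis
      using path_between_two_vertices xp(2) xq(2) less.prems by metis
  next
    case False
    then have x: "?x \<noteq> u" "?x \<noteq> v" by auto
    obtain p1 p2 where p12: "p1 \<in> P" "p2 \<in> P" "path_between G u ?x p1" "path_between G ?x v p2"
        "p = (fst p1 \<union> fst p2, snd p1 \<union> snd p2)" "card (fst p1) < card (fst p)"
        "card (fst p2) < card (fst p)"
      by (rule consistent_split [OF P less.prems(1,2) xp(1) x])
    obtain q1 q2 where q12: "q1 \<in> Q" "q2 \<in> Q" "path_between G u ?x q1" "path_between G ?x v q2"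
        "q = (fst q1 \<union> fst q2, snd q1 \<union> snd q2)" "card (fst q1) < card (fst q)"
        "card (fst q2) < card (fst q)"
      by (rule consistent_split [OF Q less.prems(3,4) xq(1) x])
    have "p1 = q1"
      using less.hyps [OF p12(6,1,3) q12(1,3)] x by simp
    moreover have "p2 = q2"
      using less.hyps [OF p12(7,2,4) q12(2,4)] x by simp
    ultimately show ?thesis using p12(5) q12(5) by simp
  qed
qed

definition vertex_pairs :: "'a set \<Rightarrow> 'a set set" where
  "vertex_pairs V = {e. e \<subseteq> V \<and> card e = 2}"

lemma vertex_pairs_iff: "e \<in> vertex_pairs V \<longleftrightarrow> (\<exists>u\<in>V. \<exists>v\<in>V. u \<noteq> v \<and> e = {u, v})"
  by (auto simp: vertex_pairs_def card_2_iff)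

lemma doubleton_in_vertex_pairs [simp]: "{u, v} \<in> vertex_pairs V \<longleftrightarrow> u \<in> V \<and> v \<in> V \<and> u \<noteq> v"
  by (cases "u = v") (auto simp: vertex_pairs_def)

lemma finite_vertex_pairs: "finite V \<Longrightarrow> finite (vertex_pairs V)"
  by (auto simp: vertex_pairs_def)

lemma card_vertex_pairs: "finite V \<Longrightarrow> card (vertex_pairs V) = card V choose 2"
  by (simp add: vertex_pairs_def n_subsets)

theorem card_consistent_path_systems_le:
  fixes G :: "'a ugraph"
  assumes V: "finite (fst G)"
  shows "finite {P. consistent_path_system G P}"
    and "card {P. consistent_path_system G P} \<le> card (fst G) ^ (card (fst G) choose 2)"
proof -
  let ?C = "{P. consistent_path_system G P}" and ?E = "vertex_pairs (fst G)"
  let ?f = "\<lambda>P. restrict (interior_code G P) ?E"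
  have inj: "inj_on ?f ?C"
  proof (rule inj_onI)
    have sub: "P \<subseteq> Q"
      if P: "consistent_path_system G P" and Q: "consistent_path_system G Q" and eq: "?f P = ?f Q"
      for P Q
    proof
      fix p assume p: "p \<in> P"
      then obtain u v where uv: "u \<in> fst G" "v \<in> fst G" "u \<noteq> v" "path_between G u v p"
        using P unfolding consistent_path_system_def by blast
      then obtain q where q: "q \<in> Q" "path_between G u v q"
        using Q unfolding consistent_path_system_def by blast
      have "interior_code G P {a, b} = interior_code G Q {a, b}"
        if "a \<in> fst G" "b \<in> fst G" "a \<noteq> b" for a b
        using fun_cong [OF eq, of "{a, b}"] that by simp
      then have "p = q"
        using paths_eq_if_same_code [OF P Q _ p uv(4) q uv(3)] by blast
      then show "p \<in> Q" using q by simp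
    qed
    fix P Q assume "P \<in> ?C" "Q \<in> ?C" "?f P = ?f Q"
    then show "P = Q" using sub [of P Q] sub [of Q P] by auto
  qed
  have img: "?f ` ?C \<subseteq> ?E \<rightarrow>\<^sub>E fst G"
  proof -
    have "interior_code G P e \<in> fst G" if P: "consistent_path_system G P" and e: "e \<in> ?E" for P e
    proof -
      obtain u v where uv: "u \<in> fst G" "v \<in> fst G" "u \<noteq> v" "e = {u, v}"
        using e by (auto simp: vertex_pairs_iff)
      then obtain p where p: "p \<in> P" "path_between G u v p"
        using P unfolding consistent_path_system_def by blast
      have "fst p \<subseteq> fst G" using p(2) by (auto simp: path_between_def)
      then show ?thesis using interior_code(1) [OF P p uv(3)] uv(4) by blast
    qed
    then show ?thesis by auto
  qed
  have fin: "finite (?E \<rightarrow>\<^sub>E fst G)"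
    using V by (intro finite_PiE finite_vertex_pairs)
  show "finite ?C"
    using inj_on_finite [OF inj img fin] .
  show "card ?C \<le> card (fst G) ^ (card (fst G) choose 2)"
    using card_inj_on_le [OF inj img fin] V
    by (simp add: card_PiE finite_vertex_pairs card_vertex_pairs)
qed

section \<open>Routing through hubs\<close>

text \<open>All paths of a hub system have the shape of a hub \<open>c\<close> joined to one or two further vertices.
  An edge \<open>{c, x}\<close> is covered by \<open>e = {x}\<close>, so that intersections of edges and of two-edge paths
  can be computed by the same two rules.\<close>

definition star :: "'a \<Rightarrow> 'a set \<Rightarrow> 'a ugraph" where
  "star c e = (insert c e, (\<lambda>u. {c, u}) ` e)"

definition hub_route :: "'a set \<Rightarrow> ('a set \<Rightarrow> 'a) \<Rightarrow> 'a set \<Rightarrow> 'a ugraph" where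
  "hub_route H \<chi> e = (if e \<inter> H \<noteq> {} then (e, {e}) else star (\<chi> e) e)"

lemma star_single: "star c {x} = ({c, x}, {{c, x}})"
  by (simp add: star_def)

lemma star_inter: "graph_inter (star c e) (star c f) = star c (e \<inter> f)"
proof -
  have "inj (\<lambda>u. {c, u})" by (auto simp: inj_def doubleton_eq_iff)
  then show ?thesis by (simp add: star_def graph_inter_def image_Int)
qed

lemma star_inter_other_centre:
  assumes "c \<noteq> d" "c \<notin> f" "d \<notin> e"
  shows "graph_inter (star c e) (star d f) = (e \<inter> f, {})"
proof -
  have "{c, u} \<noteq> {d, v}" if "v \<in> f" for u v
    using assms(1,2) that by (auto simp: doubleton_eq_iff)
  then have "(\<lambda>u. {c, u}) ` e \<inter> (\<lambda>u. {d, u}) ` f = {}" by blast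
  then show ?thesis using assms by (auto simp: star_def graph_inter_def)
qed

lemma card2_inter:
  assumes "(\<exists>x. f = {x}) \<or> card f = 2" "(\<exists>x. g = {x}) \<or> card g = 2"
  shows "f \<inter> g = {} \<or> (\<exists>x. f \<inter> g = {x}) \<or> (f = g \<and> card f = 2)"
proof (cases "card f = 2 \<and> card g = 2")
  case True
  then obtain a b c d where "f = {a, b}" "g = {c, d}" by (auto simp: card_2_iff)
  then show ?thesis using True by (cases "a \<in> g"; cases "b \<in> g") auto
next
  case False
  then show ?thesis using assms by blast
qed

lemma vertices_complete_graph [simp]: "fst (complete_graph n) = {1..n}"
  by (simp add: complete_graph_def)

locale hub_routing =
  fixes n :: nat and H :: "nat set" and \<chi> :: "nat set \<Rightarrow> nat"
  assumes hubs: "H \<subseteq> {1..n}"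
    and \<chi>: "\<And>e. e \<in> vertex_pairs ({1..n} - H) \<Longrightarrow> \<chi> e \<in> H"
begin

abbreviation "G \<equiv> complete_graph n"
abbreviation "route \<equiv> hub_route H \<chi>"
abbreviation "system \<equiv> route ` vertex_pairs {1..n}"

lemma route_cases:
  assumes "e \<in> vertex_pairs {1..n}"
  obtains (edge) "e \<inter> H \<noteq> {}" "route e = (e, {e})"
  | (star) "e \<inter> H = {}" "route e = star (\<chi> e) e" "\<chi> e \<in> H" "\<chi> e \<notin> e"
proof (cases "e \<inter> H = {}")
  case True
  then have "\<chi> e \<in> H" using assms by (intro \<chi>) (auto simp: vertex_pairs_def)
  then show thesis using True star by (auto simp: hub_route_def)
next
  case False
  then show thesis using edge by (auto simp: hub_route_def)
qed

lemma route_path: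
  assumes "u \<in> {1..n}" "v \<in> {1..n}" "u \<noteq> v"
  shows "path_between G u v (route {u, v})"
proof -
  have "{u, v} \<in> vertex_pairs {1..n}" using assms by simp
  then show ?thesis
  proof (cases rule: route_cases)
    case edge
    then show ?thesis unfolding path_between_def using assms
      by (intro exI [of _ "[u, v]"]) (auto simp: complete_graph_def)
  next
    case star
    let ?c = "\<chi> {u, v}"
    have c: "?c \<in> {1..n}" "?c \<noteq> u" "?c \<noteq> v" using star hubs by auto
    have "route {u, v} = (set [u, ?c, v], walk_edges [u, ?c, v])"
      by (auto simp: star(2) star_def)
    then show ?thesis unfolding path_between_def using assms c
      by (intro exI [of _ "[u, ?c, v]"]) (auto simp: complete_graph_def)
  qed
qed

lemma route_ends:
  assumes "e \<in> vertex_pairs {1..n}" "path_between G u v (route e)"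
  shows "u \<noteq> v" "e = {u, v}"
proof -
  have ce: "card e = 2" "finite e"
    using assms(1) by (auto simp: vertex_pairs_def intro: card_ge_0_finite)
  have ne: "snd (route e) \<noteq> {}"
    using ce by (auto simp: hub_route_def star_def)
  show uv: "u \<noteq> v"
  proof
    assume "u = v"
    obtain xs where xs: "xs \<noteq> []" "distinct xs" "hd xs = u" "last xs = v"
        "route e = (set xs, walk_edges xs)"
      using assms(2) by (auto simp: path_between_def)
    then have "xs = [u]" using \<open>u = v\<close>
      by (cases xs) (auto split: if_splits)
    then show False using xs(5) ne by simp
  qed
  have sub: "{u, v} \<subseteq> e"
    using assms(1)
  proof (cases rule: route_cases)
    case edge
    then show ?thesis using path_between_ends [OF assms(2)] by simp
  next
    case star
    have "x \<in> e" if x: "path_between G x y (route e)" "x \<noteq> y" for x y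
    proof -
      have "x \<noteq> \<chi> e"
      proof
        assume "x = \<chi> e"
        obtain a b where ab: "e = {a, b}" "a \<noteq> b" using ce by (auto simp: card_2_iff)
        then have "{x, a} \<in> snd (route e)" "{x, b} \<in> snd (route e)"
          using \<open>x = \<chi> e\<close> star(2) by (simp_all add: star_def)
        then have "{x, a} = {x, b}"
          using path_between_edge_at_end [OF x] by blast
        then show False using ab(2) by (auto simp: doubleton_eq_iff)
      qed
      then show ?thesis
        using path_between_ends [OF x(1)] star(2) by (auto simp: star_def)
    qed
    then show ?thesis using assms(2) uv path_between_commute by (metis empty_subsetI insert_subset)
  qed
  show "e = {u, v}"
    using sub ce uv by (metis card_2_iff card_subset_eq)
qed

lemma route_as_star:
  assumes "e \<in> vertex_pairs {1..n}"
  obtains c f where "route e = star c f" "c \<in> H" "c \<notin> f" "f \<noteq> {}" "f \<subseteq> {1..n}"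
    "(\<exists>x. f = {x}) \<or> (f = e \<and> card e = 2 \<and> c = \<chi> e \<and> e \<inter> H = {})"
  using assms
proof (cases rule: route_cases)
  case edge
  then obtain c where "c \<in> e" "c \<in> H" by blast
  then obtain x where "e = {c, x}" "x \<noteq> c"
    using assms by (auto simp: vertex_pairs_iff)
  then show ?thesis
    using that [of c "{x}"] edge \<open>c \<in> H\<close> assms by (auto simp: star_single vertex_pairs_def)
next
  case star
  then show ?thesis
    using that [of "\<chi> e" e] assms by (fastforce simp: vertex_pairs_def)
qed

lemma star_single_in_system:
  assumes "c \<in> H" "x \<in> {1..n}" "x \<noteq> c"
  shows "star c {x} \<in> system"
proof -
  have "star c {x} = route {c, x}" "{c, x} \<in> vertex_pairs {1..n}"
    using assms hubs by (auto simp: star_single hub_route_def)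
  then show ?thesis by blast
qed

text \<open>Write both paths as stars. With a common centre \<open>c\<close>, the intersection is again a star around
  \<open>c\<close>, and it is either the single vertex \<open>c\<close>, an edge at a hub, or one of the two paths itself. A
  centre that is a leaf of the other star can occur only if that star is an edge between two hubs,
  which may be recentred. In all other cases the stars share no edge and at most one vertex, since
  two-leaf stars with the same leaves have the same centre.\<close>

lemma route_inter:
  assumes p: "p \<in> system" and q: "q \<in> system" and meet: "fst p \<inter> fst q \<noteq> {}"
  shows "(\<exists>x. graph_inter p q = ({x}, {})) \<or> graph_inter p q \<in> system"
proof -
  have same: ?thesis
    if pf: "p = star c f" and qg: "q = star c g" and c: "c \<in> H" "c \<notin> f" "c \<notin> g"
      and f: "f \<subseteq> {1..n}" "(\<exists>x. f = {x}) \<or> card f = 2" for c f g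
  proof -
    have I: "graph_inter p q = star c (f \<inter> g)"
      using star_inter [of c f g] pf qg by simp
    consider "f \<inter> g = {}" | x where "f \<inter> g = {x}" | "f \<inter> g = f"
      using f(2) by (auto simp: card_2_iff)
    then show ?thesis
    proof cases
      case 1
      then show ?thesis using I by (auto simp: star_def)
    next
      case 2
      then have "x \<in> f" "x \<in> g" by auto
      then have "x \<in> {1..n}" "x \<noteq> c" using c f(1) by auto
      then show ?thesis
        using I 2 star_single_in_system [OF c(1)] by simp
    next
      case 3
      then show ?thesis using I p pf by simp
    qed
  qed
  obtain e e' where e: "e \<in> vertex_pairs {1..n}" "p = route e"
    and e': "e' \<in> vertex_pairs {1..n}" "q = route e'"
    using p q by blast
  obtain c f where f: "p = star c f" "c \<in> H" "c \<notin> f" "f \<noteq> {}" "f \<subseteq> {1..n}"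
    "(\<exists>x. f = {x}) \<or> (f = e \<and> card e = 2 \<and> c = \<chi> e \<and> e \<inter> H = {})"
    using route_as_star [OF e(1)] e(2) by metis
  obtain d g where g: "q = star d g" "d \<in> H" "d \<notin> g" "g \<noteq> {}" "g \<subseteq> {1..n}"
    "(\<exists>x. g = {x}) \<or> (g = e' \<and> card e' = 2 \<and> d = \<chi> e' \<and> e' \<inter> H = {})"
    using route_as_star [OF e'(1)] e'(2) by metis
  have f2: "(\<exists>x. f = {x}) \<or> card f = 2" using f(6) by auto
  have g2: "(\<exists>x. g = {x}) \<or> card g = 2" using g(6) by auto
  consider "c = d" | "c \<noteq> d" "c \<in> g" | "c \<noteq> d" "d \<in> f" | "c \<noteq> d" "c \<notin> g" "d \<notin> f" by blast
  then show ?thesis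
  proof cases
    case 1
    then show ?thesis using same f g f2 by blast
  next
    case 2
    then have "g = {c}" using g(6) f(2) by auto
    then have "q = star c {d}" using g(1) by (simp add: star_single insert_commute)
    then show ?thesis using same [of c f "{d}"] f f2 2 by blast
  next
    case 3
    then have "f = {d}" using f(6) g(2) by auto
    then have "p = star d {c}" using f(1) by (simp add: star_single insert_commute)
    then show ?thesis using same [of d "{c}" g] f g 3 hubs by (metis (lifting) empty_subsetI insert_subset singletonD subsetD)
  next
    case 4
    have I: "graph_inter p q = (f \<inter> g, {})"
      using star_inter_other_centre [of c d g f] f(1) g(1) 4 by simp
    have "f \<inter> g \<noteq> {}"
      using meet I by (auto simp: graph_inter_def)
    moreover have "\<not> (f = g \<and> card f = 2)"
      using f(6) g(6) 4(1) by auto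
    ultimately have "\<exists>x. f \<inter> g = {x}"
      using card2_inter [OF f2 g2] by blast
    then show ?thesis using I by auto
  qed
qed

lemma system_consistent: "consistent_path_system G system"
  unfolding consistent_path_system_def
proof (intro conjI ballI impI)
  show "simple_graph G" by (rule simple_graph_complete_graph)
next
  fix p assume "p \<in> system"
  then obtain u v where "u \<in> {1..n}" "v \<in> {1..n}" "u \<noteq> v" "p = route {u, v}"
    by (auto simp: vertex_pairs_iff)
  then show "\<exists>u\<in>fst G. \<exists>v\<in>fst G. u \<noteq> v \<and> path_between G u v p"
    using route_path unfolding vertices_complete_graph by blast
next
  fix u v assume uv: "u \<in> fst G" "v \<in> fst G" "u \<noteq> v"
  then have V: "u \<in> {1..n}" "v \<in> {1..n}" by simp_all
  then have "{u, v} \<in> vertex_pairs {1..n}" using uv(3) by simp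
  then show "\<exists>!p. p \<in> system \<and> path_between G u v p"
    using route_path [OF V uv(3)] route_ends(2) by blast
next
  fix p q assume "p \<in> system" "q \<in> system" "fst p \<inter> fst q \<noteq> {}"
  then show "(\<exists>x. graph_inter p q = ({x}, {})) \<or> graph_inter p q \<in> system"
    by (rule route_inter)
qed

text \<open>The weight 2 of the edges that avoid \<open>H\<close> is just large enough that such an edge does not beat
  a route through a hub: a path between two vertices outside \<open>H\<close> is either their edge, of weight 2,
  or has at least two edges, of weight at least 1 each.\<close>

lemma system_metric: "metric_path_system G system"
proof -
  define w :: "nat set \<Rightarrow> real" where "w e = (if e \<inter> H \<noteq> {} then 1 else 2)" for e
  have w1: "w e \<ge> 1" for e by (simp add: w_def)
  have lower: "path_weight w (route {u, v}) \<le> path_weight w q"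
    if uv: "u \<noteq> v" "{u, v} \<in> vertex_pairs {1..n}" and q: "path_between G u v q" for u v q
  proof -
    obtain xs where xs: "xs \<noteq> []" "distinct xs" "hd xs = u" "last xs = v"
        "q = (set xs, walk_edges xs)"
      using q by (auto simp: path_between_def)
    then obtain y zs where xs': "xs = u # y # zs"
      using uv(1) by (metis last.simps list.collapse)
    have ge: "sum w F \<le> path_weight w q" if "F \<subseteq> walk_edges xs" for F
      unfolding path_weight_def using that xs(5) w1 finite_walk_edges
      by (auto intro!: sum_mono2 order_trans [OF zero_le_one w1])
    show ?thesis
      using uv(2)
    proof (cases rule: route_cases)
      case edge
      have "path_weight w (route {u, v}) = 1"
        using edge by (simp add: path_weight_def w_def)
      also have "1 \<le> sum w {{u, y}}" using w1 by simp
      also have "\<dots> \<le> path_weight w q" by (rule ge) (simp add: xs')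
      finally show ?thesis .
    next
      case star
      have "path_weight w (route {u, v}) = 2"
        using star uv(1) by (auto simp: path_weight_def star_def w_def doubleton_eq_iff)
      also have "2 \<le> path_weight w q"
      proof (cases zs)
        case Nil
        then have "walk_edges xs = {{u, v}}" using xs xs' by simp
        then show ?thesis using star(1) xs(5) by (simp add: path_weight_def w_def)
      next
        case (Cons z zs')
        have "2 \<le> sum w {{u, y}, {y, z}}"
          using xs(2) xs' Cons w1 [of "{u, y}"] w1 [of "{y, z}"]
          by (auto simp: doubleton_eq_iff)
        also have "\<dots> \<le> path_weight w q" by (rule ge) (simp add: xs' Cons)
        finally show ?thesis .
      qed
      finally show ?thesis .
    qed
  qed
  have "shortest_path G w u v p" if "p \<in> system" "path_between G u v p" for p u v
  proof -
    obtain e where "e \<in> vertex_pairs {1..n}" "p = route e" using \<open>p \<in> system\<close> by blast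
    then show ?thesis
      using route_ends lower that unfolding shortest_path_def by metis
  qed
  moreover have "w e > 0" for e using w1 [of e] by linarith
  ultimately show ?thesis unfolding metric_path_system_def by blast
qed

end

text \<open>The hub chosen for a pair \<open>e\<close> can be read off from the system, since the ends of a path are
  determined by the path and so only one member belongs to \<open>e\<close>.\<close>

lemma hub_systems_distinct:
  fixes n :: nat and H :: "nat set"
  assumes H: "H \<subseteq> {1..n}"
    and \<chi>: "\<chi> \<in> vertex_pairs ({1..n} - H) \<rightarrow>\<^sub>E H" and \<psi>: "\<psi> \<in> vertex_pairs ({1..n} - H) \<rightarrow>\<^sub>E H"
    and eq: "hub_route H \<chi> ` vertex_pairs {1..n} = hub_route H \<psi> ` vertex_pairs {1..n}"
  shows "\<chi> = \<psi>"
proof (rule PiE_ext [OF \<chi> \<psi>])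
  interpret A: hub_routing n H \<chi> using H \<chi> by unfold_locales auto
  interpret B: hub_routing n H \<psi> using H \<psi> by unfold_locales auto
  fix e assume e: "e \<in> vertex_pairs ({1..n} - H)"
  then have eV: "e \<in> vertex_pairs {1..n}" and eH: "e \<inter> H = {}"
    by (auto simp: vertex_pairs_def)
  obtain u v where uv: "u \<in> {1..n}" "v \<in> {1..n}" "u \<noteq> v" "e = {u, v}"
    using eV by (auto simp: vertex_pairs_iff)
  have "hub_route H \<chi> e \<in> hub_route H \<psi> ` vertex_pairs {1..n}" using eV eq by blast
  then obtain f where f: "f \<in> vertex_pairs {1..n}" "hub_route H \<chi> e = hub_route H \<psi> f" by blast
  have "f = e"
    using B.route_ends(2) [OF f(1)] A.route_path [OF uv(1-3)] uv(4) f(2) by metis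
  then have "insert (\<chi> e) e = insert (\<psi> e) e"
    using f(2) eH by (simp add: hub_route_def star_def)
  moreover have "\<chi> e \<in> H" "\<psi> e \<in> H" using e \<chi> \<psi> by auto
  ultimately show "\<chi> e = \<psi> e" using eH by blast
qed

lemma card_metric_systems_ge:
  assumes "h \<le> n"
  shows "h ^ (n - h choose 2) \<le> card (metric_systems n)"
proof -
  let ?H = "{1..h}"
  let ?E = "vertex_pairs ({1..n} - ?H)"
  let ?F = "?E \<rightarrow>\<^sub>E ?H"
  let ?S = "\<lambda>\<chi>. hub_route ?H \<chi> ` vertex_pairs {1..n}"
  have H: "?H \<subseteq> {1..n}" using assms by auto
  have "inj_on ?S ?F"
    using hub_systems_distinct [OF H] by (intro inj_onI) blast
  moreover have "?S ` ?F \<subseteq> metric_systems n"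
  proof -
    have "?S \<chi> \<in> metric_systems n" if "\<chi> \<in> ?F" for \<chi>
    proof -
      interpret hub_routing n ?H \<chi> using H that by unfold_locales auto
      show ?thesis
        using system_consistent system_metric by (simp add: metric_systems_def consistent_systems_def)
    qed
    then show ?thesis by blast
  qed
  moreover have "finite (metric_systems n)"
    using card_consistent_path_systems_le(1) [of "complete_graph n"]
    by (simp add: metric_systems_def consistent_systems_def)
  ultimately have "card ?F \<le> card (metric_systems n)" by (rule card_inj_on_le)
  moreover have "card ({1..n} - ?H) = n - h"
    using H by (simp add: card_Diff_subset)
  ultimately show ?thesis
    by (simp add: card_PiE finite_vertex_pairs card_vertex_pairs)
qed

section \<open>Asymptotics\<close>

text \<open>The summand 1 in the denominator and the rounding up keep the number of hubs between 1 and
  \<open>n\<close> for all \<open>n \<ge> 1\<close>.\<close>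

definition hub_count :: "nat \<Rightarrow> nat" where
  "hub_count n = nat \<lceil>real n / (1 + ln (real n))\<rceil>"

lemma hub_count_bounds:
  assumes "n \<ge> 1"
  shows "1 \<le> hub_count n" "hub_count n \<le> n"
proof -
  have ln: "0 \<le> ln (real n)" using assms by simp
  have "0 < real n / (1 + ln (real n))"
    using assms ln by (intro divide_pos_pos) linarith+
  then show "1 \<le> hub_count n" unfolding hub_count_def by linarith
  have "real n / (1 + ln (real n)) \<le> real n / 1"
    using ln by (intro divide_left_mono) auto
  then show "hub_count n \<le> n" unfolding hub_count_def by linarith
qed

text \<open>The exponent for which \<open>n powr (n\<^sup>2 / 2 * hub_exponent n)\<close> equals the number of hub systems.
  Its denominator vanishes at \<open>n = 1\<close>, where any exponent serves.\<close>

definition hub_exponent :: "nat \<Rightarrow> real" where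
  "hub_exponent n = real (n - hub_count n choose 2) * ln (real (hub_count n)) /
     ((real n)\<^sup>2 / 2 * ln (real n))"

lemma real_choose_two: "real (m choose 2) = real m * (real m - 1) / 2"
  by (induction m) (auto simp: numeral_2_eq_2 field_simps)

lemma hub_exponent_tendsto: "hub_exponent \<longlonglongrightarrow> 1"
proof -
  define c where "c n = real_of_int \<lceil>real n / (1 + ln (real n))\<rceil>" for n :: nat
  have "(\<lambda>n. (real n - c n) * (real n - c n - 1) / 2 * ln (c n) /
     ((real n)\<^sup>2 / 2 * ln (real n))) \<longlonglongrightarrow> 1"
    unfolding c_def by real_asymp
  moreover have "\<forall>\<^sub>F n in sequentially. (real n - c n) * (real n - c n - 1) / 2 * ln (c n) /
     ((real n)\<^sup>2 / 2 * ln (real n)) = hub_exponent n"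
    using eventually_ge_at_top [of 1]
  proof eventually_elim
    case (elim n)
    have "real (hub_count n) = c n"
      using hub_count_bounds(1) [OF elim] unfolding c_def hub_count_def by simp
    then show ?case
      using hub_count_bounds(2) [OF elim]
      by (simp add: hub_exponent_def real_choose_two of_nat_diff)
  qed
  ultimately show ?thesis by (rule Lim_transform_eventually)
qed

theorem theorem3p4:
  "\<exists>\<epsilon> :: nat \<Rightarrow> real. \<epsilon> \<in> o(\<lambda>_. 1) \<and>
     (\<forall>n\<ge>1.
        real n powr ((real n)\<^sup>2 / 2 * (1 - \<epsilon> n)) \<le> real (card (metric_systems n)) \<and>
        card (metric_systems n) \<le> card (consistent_systems n) \<and>
        real (card (consistent_systems n)) \<le> real n powr ((real n)\<^sup>2 / 2))"
proof (intro exI [of _ "\<lambda>n. 1 - hub_exponent n"] conjI allI impI)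
  have "(\<lambda>n. 1 - hub_exponent n) \<longlonglongrightarrow> 0"
    using tendsto_diff [OF tendsto_const [of 1] hub_exponent_tendsto] by simp
  then show "(\<lambda>n. 1 - hub_exponent n) \<in> o(\<lambda>_. 1)"
    by (intro smalloI_tendsto) auto
next
  fix n :: nat assume n: "n \<ge> 1"
  let ?h = "hub_count n"
  note h = hub_count_bounds [OF n]
  have "real n powr ((real n)\<^sup>2 / 2 * (1 - (1 - hub_exponent n))) \<le> real (?h ^ (n - ?h choose 2))"
  proof (cases "n = 1")
    case True
    then have "?h = 1" using h by simp
    then show ?thesis using True by simp
  next
    case False
    then have "ln (real n) > 0" using n by simp
    then have "real n powr ((real n)\<^sup>2 / 2 * hub_exponent n) =
        exp (real (n - ?h choose 2) * ln (real ?h))"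
      using n by (simp add: powr_def hub_exponent_def)
    also have "\<dots> = real (?h ^ (n - ?h choose 2))"
      using h by (simp add: exp_of_nat_mult)
    finally show ?thesis by simp
  qed
  also have "\<dots> \<le> real (card (metric_systems n))"
    using card_metric_systems_ge [OF h(2)] by (simp only: of_nat_le_iff)
  finally show "real n powr ((real n)\<^sup>2 / 2 * (1 - (1 - hub_exponent n))) \<le>
      real (card (metric_systems n))" .
next
  fix n :: nat
  have "finite (consistent_systems n)"
    using card_consistent_path_systems_le(1) [of "complete_graph n"]
    by (simp add: consistent_systems_def)
  then show "card (metric_systems n) \<le> card (consistent_systems n)"
    by (rule card_mono) (auto simp: metric_systems_def)
next
  fix n :: nat assume n: "n \<ge> 1"
  have "card (consistent_systems n) \<le> n ^ (n choose 2)"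
    using card_consistent_path_systems_le(2) [of "complete_graph n"]
    by (simp add: consistent_systems_def)
  then have "real (card (consistent_systems n)) \<le> real n ^ (n choose 2)"
    by (metis of_nat_le_iff of_nat_power)
  also have "\<dots> = real n powr real (n choose 2)"
    using n by (simp add: powr_realpow)
  also have "\<dots> \<le> real n powr ((real n)\<^sup>2 / 2)"
    using n by (intro powr_mono) (auto simp: real_choose_two power2_eq_square)
  finally show "real (card (consistent_systems n)) \<le> real n powr ((real n)\<^sup>2 / 2)" .
qed

end
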